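(* Let $I$ be an open interval in $\mathbb{R}$. If $f \in S^1(I)$, then $f^{\mathrm{sd}} \in B^1(I)$.
   Context: For an open interval $I\subset\mathbb{R}$, a function $f:I\to\mathbb{R}$ and a point $x\in I$, the specular derivative of $f$ at $x$ is $$f^{\mathrm{sd}}(x) := \lim_{h \searrow 0} \mathcal{A}(f(x + h) - f(x), f(x) - f(x - h), h)$$ (with $h>0$ small enough that $x\pm h\in I$), where $\mathcal{A}:\mathbb{R}\times\mathbb{R}\times(0,\infty)\to\mathbb{R}$ is $$\mathcal{A}(a, b, c) := \frac{a \sqrt{b^2 + c^2} + b \sqrt{a^2 + c^2}}{c \sqrt{a^2 + c^2} + c \sqrt{b^2 + c^2}}.$$ $f$ is specularly differentiable at $x$ if this limit exists as a finite real number, and specularly differentiable on $I$ if it is so at every point of $I$. $S^0(I)$ is the set of functions $f:I\to\mathbb{R}$ that are specularly differentiable on $I$, and $S^1(I):=C^0(I)\cap S^0(I)$, where $C^0(I)$ is the set of continuous real-valued functions on $I$. $B^1(I)$ denotes the class of Baire class $1$ functions on $I$, i.e. pointwise limits on $I$ of sequences of continuous real-valued functions on $I$. *)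

theory Defs
  imports "HOL-Analysis.Analysis"
begin

text \<open>Only meant for \<open>c > 0\<close>, where the denominator is positive.\<close>

definition specular_A :: "real \<Rightarrow> real \<Rightarrow> real \<Rightarrow> real" where
  "specular_A a b c =
     (a * sqrt (b\<^sup>2 + c\<^sup>2) + b * sqrt (a\<^sup>2 + c\<^sup>2)) /
     (c * sqrt (a\<^sup>2 + c\<^sup>2) + c * sqrt (b\<^sup>2 + c\<^sup>2))"

text \<open>
  Functions on an open interval \<open>I\<close> are represented by total functions, and all notions below
  depend only on the values on \<open>I\<close>: for \<open>x \<in> I\<close> the limit as \<open>h\<close> decreases to \<open>0\<close> only
  involves \<open>h > 0\<close> small enough that \<open>x + h\<close> and \<open>x - h\<close> lie in \<open>I\<close>.
\<close>

definition has_specular_derivative :: "(real \<Rightarrow> real) \<Rightarrow> real \<Rightarrow> real \<Rightarrow> bool" where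
  "has_specular_derivative f D x \<longleftrightarrow>
     ((\<lambda>h. specular_A (f (x + h) - f x) (f x - f (x - h)) h) \<longlongrightarrow> D) (at_right 0)"

definition specular_differentiable :: "(real \<Rightarrow> real) \<Rightarrow> real \<Rightarrow> bool" where
  "specular_differentiable f x \<longleftrightarrow> (\<exists>D. has_specular_derivative f D x)"

text \<open>Unspecified at points where \<open>f\<close> is not specularly differentiable.\<close>

definition specular_deriv :: "(real \<Rightarrow> real) \<Rightarrow> real \<Rightarrow> real" where
  "specular_deriv f x =
     Lim (at_right 0) (\<lambda>h. specular_A (f (x + h) - f x) (f x - f (x - h)) h)"

lemma has_specular_derivative_imp_deriv:
  "has_specular_derivative f D x \<Longrightarrow> specular_deriv f x = D"
  unfolding has_specular_derivative_def specular_deriv_def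
  by (rule tendsto_Lim) simp_all

definition S0 :: "real set \<Rightarrow> (real \<Rightarrow> real) set" where
  "S0 I = {f. \<forall>x\<in>I. specular_differentiable f x}"

definition S1 :: "real set \<Rightarrow> (real \<Rightarrow> real) set" where
  "S1 I = {f. continuous_on I f} \<inter> S0 I"

definition Baire1 :: "real set \<Rightarrow> (real \<Rightarrow> real) set" where
  "Baire1 I = {f. \<exists>g :: nat \<Rightarrow> real \<Rightarrow> real.
     (\<forall>n. continuous_on I (g n)) \<and> (\<forall>x\<in>I. (\<lambda>n. g n x) \<longlonglongrightarrow> f x)}"

end

theory Submission
  imports Defs
begin

text \<open>
  The specular derivative at \<open>x\<close> is the limit of the quotients
  \<open>specular_A (f (x + h) - f x) (f x - f (x - h)) h\<close>, and for a fixed step \<open>h\<close> such a quotient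
  is continuous in \<open>x\<close> because \<open>f\<close> and \<open>specular_A\<close> are. With \<open>h = 1 / n\<close> this would exhibit the
  derivative as a pointwise limit of continuous functions, except that near the boundary of \<open>I\<close>
  the points \<open>x + h\<close> and \<open>x - h\<close> leave \<open>I\<close>, where \<open>f\<close> need not be continuous.

  The remedy is a step that depends on the point: \<open>h = r x / (n + 2)\<close>, where \<open>r\<close> is a continuous
  positive function on \<open>I\<close> such that the ball of radius \<open>r x\<close> around \<open>x\<close> lies in \<open>I\<close>
  (\<open>open_continuous_radius\<close>). Each quotient is then continuous on all of \<open>I\<close>
  (\<open>continuous_on_specular_quotient\<close>), and at every point the steps decrease to \<open>0\<close> through
  positive values, so the quotients converge to the specular derivative.
\<close>

text \<open>
  The distance to the complement is such a radius. The whole space is a separate case, as the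
  distance to the empty set is \<open>0\<close> by convention.
\<close>

lemma open_continuous_radius:
  fixes I :: "'a::metric_space set"
  assumes "open I"
  obtains r :: "'a \<Rightarrow> real"
  where "continuous_on I r" "\<And>x. x \<in> I \<Longrightarrow> 0 < r x" "\<And>x. x \<in> I \<Longrightarrow> ball x (r x) \<subseteq> I"
proof (cases "I = UNIV")
  case True
  then show ?thesis
    using that[of "\<lambda>_. 1"] by simp
next
  case False
  then have ne: "- I \<noteq> {}"
    by auto
  show ?thesis
  proof (rule that[of "\<lambda>x. infdist x (- I)"])
    show "continuous_on I (\<lambda>x. infdist x (- I))"
      by (intro continuous_intros)
    show "0 < infdist x (- I)" if "x \<in> I" for x
      using that assms ne by (intro infdist_pos_not_in_closed) (auto simp: closed_Compl)
    show "ball x (infdist x (- I)) \<subseteq> I" if "x \<in> I" for x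
      using infdist_le[of _ "- I" x] by (force simp: not_le[symmetric])
  qed
qed

lemma continuous_on_specular_A:
  assumes "continuous_on S a" "continuous_on S b" "continuous_on S c"
    and pos: "\<And>x. x \<in> S \<Longrightarrow> 0 < c x"
  shows "continuous_on S (\<lambda>x. specular_A (a x) (b x) (c x))"
proof -
  have "c x * sqrt ((a x)\<^sup>2 + (c x)\<^sup>2) + c x * sqrt ((b x)\<^sup>2 + (c x)\<^sup>2) \<noteq> 0" if "x \<in> S" for x
  proof -
    have "0 < c x * sqrt ((a x)\<^sup>2 + (c x)\<^sup>2)" "0 < c x * sqrt ((b x)\<^sup>2 + (c x)\<^sup>2)"
      using pos[OF that] by (simp_all add: add_nonneg_pos)
    then show ?thesis
      by linarith
  qed
  then show ?thesis
    unfolding specular_A_def using assms by (intro continuous_intros) auto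
qed

lemma continuous_on_specular_quotient:
  assumes f: "continuous_on I f" and h: "continuous_on I h"
    and pos: "\<And>x. x \<in> I \<Longrightarrow> 0 < h x"
    and inside: "\<And>x. x \<in> I \<Longrightarrow> x + h x \<in> I" "\<And>x. x \<in> I \<Longrightarrow> x - h x \<in> I"
  shows "continuous_on I (\<lambda>x. specular_A (f (x + h x) - f x) (f x - f (x - h x)) (h x))"
proof -
  have "continuous_on I (\<lambda>x. f (x + h x))" "continuous_on I (\<lambda>x. f (x - h x))"
    using h inside by (auto intro!: continuous_on_compose2[OF f] continuous_intros)
  then show ?thesis
    using f h pos by (intro continuous_on_specular_A continuous_intros)
qed

lemma specular_deriv_LIMSEQ:
  assumes "specular_differentiable f x"
    and "filterlim h (at_right 0) sequentially"
  shows "(\<lambda>n. specular_A (f (x + h n) - f x) (f x - f (x - h n)) (h n))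
           \<longlonglongrightarrow> specular_deriv f x"
proof -
  obtain D where D: "has_specular_derivative f D x"
    using assms(1) unfolding specular_differentiable_def by blast
  show ?thesis
    using filterlim_compose[OF D[unfolded has_specular_derivative_def] assms(2)]
      has_specular_derivative_imp_deriv[OF D] by simp
qed

theorem proposition5p3:
  fixes I :: "real set" and f :: "real \<Rightarrow> real"
  assumes "open I" and "is_interval I"
    and "f \<in> S1 I"
  shows "specular_deriv f \<in> Baire1 I"
proof -
  have f: "continuous_on I f" and diff: "\<And>x. x \<in> I \<Longrightarrow> specular_differentiable f x"
    using assms(3) by (auto simp: S1_def S0_def)
  obtain r where r: "continuous_on I r" and r_pos: "\<And>x. x \<in> I \<Longrightarrow> 0 < r x"
    and ball: "\<And>x. x \<in> I \<Longrightarrow> ball x (r x) \<subseteq> I"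
    using open_continuous_radius[OF assms(1)] by blast
  \<comment> \<open>The denominator exceeds \<open>1\<close> for every \<open>n\<close>, so that the step stays strictly below the radius
    of the open ball.\<close>
  define h where "h n x = r x / (real n + 2)" for n x
  define g where "g n x = specular_A (f (x + h n x) - f x) (f x - f (x - h n x)) (h n x)" for n x
  have h_pos: "0 < h n x" and h_less: "h n x < r x" if "x \<in> I" for n x
  proof -
    show "0 < h n x"
      using r_pos[OF that] by (simp add: h_def)
    have "r x * 1 < r x * (real n + 2)"
      using r_pos[OF that] by (intro mult_strict_left_mono) auto
    then show "h n x < r x"
      by (simp add: h_def divide_less_eq)
  qed
  have "continuous_on I (g n)" for n
    unfolding g_def
  proof (rule continuous_on_specular_quotient[OF f])
    show "continuous_on I (h n)"
      unfolding h_def using r by (intro continuous_intros) auto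
    show "x + h n x \<in> I" "x - h n x \<in> I" if "x \<in> I" for x
      using ball[OF that] h_pos[OF that, of n] h_less[OF that, of n]
      by (auto simp: subset_iff dist_real_def)
  qed (rule h_pos)
  moreover have "(\<lambda>n. g n x) \<longlonglongrightarrow> specular_deriv f x" if "x \<in> I" for x
    unfolding g_def
  proof (rule specular_deriv_LIMSEQ[OF diff[OF that]])
    have "filterlim (\<lambda>n. 2 + real n) at_top sequentially"
      by (rule filterlim_tendsto_add_at_top[OF tendsto_const filterlim_real_sequentially])
    then have "(\<lambda>n. r x / (2 + real n)) \<longlonglongrightarrow> 0"
      by (intro tendsto_divide_0[OF tendsto_const] filterlim_at_top_imp_at_infinity)
    then show "filterlim (\<lambda>n. h n x) (at_right 0) sequentially"
      using h_pos[OF that] by (auto simp: filterlim_at h_def add.commute)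
  qed
  ultimately show ?thesis
    unfolding Baire1_def by blast
qed

end
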